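(* Let $R$ be a unital ring with involution $*$, let $a\in R$ and let $n$ be a positive integer. Then the following conditions are equivalent: (1) $a\in R^{\dagger}$; (2) there exists a projection $p\in R$ such that $pa=a$ and $p$ is a multiple of $(aa^{*})^{n}$; (3) there exists a Hermite element $q\in R$ such that $qa=a$ and $q$ is a left multiple of $(aa^{*})^{n}$; (4) there exists a Hermite element $r\in R$ such that $ra=a$ and $r$ is a right multiple of $(aa^{*})^{n}$; (5) there exists $b\in R$ such that $ba=a$ and $b$ is a left multiple of $(aa^{*})^{n}$.
   Context: $R$ is a unital ring with an involution $a\mapsto a^*$, i.e. $(a^* )^*=a$, $(ab)^*=b^*a^*$, $(a+b)^*=a^*+b^*$. $R^{\dagger}$ is the set of Moore-Penrose invertible elements, i.e. those $a$ for which there is $b\in R$ with $aba=a$, $bab=b$, $(ab)^*=ab$, $(ba)^*=ba$. A projection is an element $p$ with $p^2=p=p^*$; a Hermite element is an element $q$ with $q^*=q$. For $c,d\in R$: $c$ is a left multiple of $d$ if $c\in Rd=\{xd\mid x\in R\}$; a right multiple of $d$ if $c\in dR=\{dx\mid x\in R\}$; a multiple of $d$ if $c\in Rd\cap dR$. *)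

theory Defs
  imports Main
begin

(* The sort {ring, monoid_mult} is that of unital rings in which 0 = 1 is allowed;
   the class ring_1 would exclude the zero ring. *)

definition ring_involution :: "('a::{ring,monoid_mult} \<Rightarrow> 'a) \<Rightarrow> bool" where
  "ring_involution star \<longleftrightarrow>
     (\<forall>a. star (star a) = a) \<and>
     (\<forall>a b. star (a * b) = star b * star a) \<and>
     (\<forall>a b. star (a + b) = star a + star b)"

definition is_MP_inverse ::
    "('a::{ring,monoid_mult} \<Rightarrow> 'a) \<Rightarrow> 'a \<Rightarrow> 'a \<Rightarrow> bool" where
  "is_MP_inverse star a b \<longleftrightarrow>
     a * b * a = a \<and> b * a * b = b \<and> star (a * b) = a * b \<and> star (b * a) = b * a"

definition MP_invertible :: "('a::{ring,monoid_mult} \<Rightarrow> 'a) \<Rightarrow> 'a set" where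
  "MP_invertible star = {a. \<exists>b. is_MP_inverse star a b}"

definition is_projection :: "('a::{ring,monoid_mult} \<Rightarrow> 'a) \<Rightarrow> 'a \<Rightarrow> bool" where
  "is_projection star p \<longleftrightarrow> p ^ 2 = p \<and> star p = p"

definition is_Hermite :: "('a::{ring,monoid_mult} \<Rightarrow> 'a) \<Rightarrow> 'a \<Rightarrow> bool" where
  "is_Hermite star q \<longleftrightarrow> star q = q"

definition left_multiple :: "'a::{ring,monoid_mult} \<Rightarrow> 'a \<Rightarrow> bool" where
  "left_multiple c d \<longleftrightarrow> c \<in> {x * d | x. True}"

definition right_multiple :: "'a::{ring,monoid_mult} \<Rightarrow> 'a \<Rightarrow> bool" where
  "right_multiple c d \<longleftrightarrow> c \<in> {d * x | x. True}"

definition two_sided_multiple :: "'a::{ring,monoid_mult} \<Rightarrow> 'a \<Rightarrow> bool" where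
  "two_sided_multiple c d \<longleftrightarrow> c \<in> {x * d | x. True} \<inter> {d * x | x. True}"

end

theory Submission
  imports Defs
begin

text \<open>
  Write \<open>s = a a\<^sup>*\<close>. If \<open>b\<close> is the Moore-Penrose inverse of \<open>a\<close>, then
  \<open>t = b\<^sup>* b\<close> inverts \<open>s\<close> on the range of the projection \<open>p = a b\<close>: both
  \<open>t s = p\<close> and \<open>p s = s\<close> hold. Hence \<open>t\<^sup>n s\<^sup>n\<close> collapses to \<open>p\<close> for every positive
  \<open>n\<close>, and applying the involution gives \<open>p = s\<^sup>n t\<^sup>n\<close> as well
  (\<open>MP_inverse_range_projection\<close>). This is the strongest of the four existence
  conditions; each of the others weakens it, and the involution exchanges left and right
  multiples of the Hermite element \<open>s\<^sup>n\<close>, so all four imply the existence of \<open>b\<close> with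
  \<open>b a = a\<close> and \<open>b \<in> R s\<^sup>n\<close>.

  Conversely, that last condition puts \<open>a = b a\<close> in \<open>R a a\<^sup>* a\<close>, because one factor
  \<open>s\<close> can be split off \<open>s\<^sup>n\<close>. A single equation \<open>a = y a a\<^sup>* a\<close> already forces
  Moore-Penrose invertibility (\<open>MP_invertible_if_left_multiple_cube\<close>): the element
  \<open>c = a\<^sup>* y\<^sup>*\<close> is an inner inverse of \<open>a\<close> for which \<open>a c\<close> and \<open>c a\<close> are both
  Hermite, and then \<open>c a c\<close> is the Moore-Penrose inverse.
\<close>

lemma ring_involution_simps:
  assumes "ring_involution star"
  shows "star (star x) = x" and "star (x * y) = star y * star x"
  using assms unfolding ring_involution_def by auto

lemma star_power:
  assumes "ring_involution star"
  shows "star (x ^ n) = star x ^ n"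
proof (induction n)
  case 0
  have "1 = star (star 1 * 1)"
    by (simp only: mult_1_right ring_involution_simps(1)[OF assms])
  also have "\<dots> = star 1 * 1"
    by (simp only: ring_involution_simps[OF assms])
  finally show ?case by simp
next
  case (Suc n)
  then show ?case
    by (simp add: ring_involution_simps[OF assms] power_commutes)
qed

lemma Hermite_power_mult_star:
  assumes "ring_involution star"
  shows "is_Hermite star ((x * star x) ^ n)"
  unfolding is_Hermite_def
  by (simp add: star_power[OF assms] ring_involution_simps[OF assms])

lemma Hermite_right_multiple_imp_left_multiple:
  assumes "ring_involution star" "is_Hermite star r" "is_Hermite star d"
    and "right_multiple r d"
  shows "left_multiple r d"
proof -
  obtain x where "r = d * x"
    using assms(4) unfolding right_multiple_def by auto
  then have "r = star x * d"
    using assms(2,3) ring_involution_simps(2)[OF assms(1)]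
    unfolding is_Hermite_def by metis
  then show ?thesis
    unfolding left_multiple_def by auto
qed

text \<open>
  The middle factors of \<open>t\<^sup>n s\<^sup>n\<close> cancel from the inside outwards: the innermost pair
  \<open>t s\<close> becomes \<open>p\<close>, which the next \<open>s\<close> absorbs. One pair has to remain to produce
  \<open>p\<close> rather than 1, so the exponent is positive.
\<close>

lemma power_mult_power_collapse:
  fixes s t p :: "'a::monoid_mult"
  assumes "t * s = p" "p * s = s" "n > 0"
  shows "t ^ n * s ^ n = p"
  using assms(3)
proof (induction n rule: nat_induct_non_zero)
  case 1
  then show ?case using assms(1) by simp
next
  case (Suc n)
  have absorb: "p * s ^ n = s ^ n"
    using \<open>n > 0\<close> assms(2) by (cases n) (simp_all add: mult.assoc[symmetric])
  have "t ^ Suc n * s ^ Suc n = t ^ n * ((t * s) * s ^ n)"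
    by (simp only: power_Suc2[of t] power_Suc[of s] mult.assoc)
  also have "\<dots> = t ^ n * s ^ n"
    by (simp only: assms(1) absorb)
  finally show ?case using Suc.IH by simp
qed

lemma MP_inverse_range_projection:
  assumes inv: "ring_involution star" and mp: "is_MP_inverse star a b" and "n > 0"
  shows "is_projection star (a * b)" and "(a * b) * a = a"
    and "two_sided_multiple (a * b) ((a * star a) ^ n)"
proof -
  note star = ring_involution_simps[OF inv]
  have aba: "a * b * a = a" and bab: "b * a * b = b"
    and ab: "star (a * b) = a * b" and ba: "star (b * a) = b * a"
    using mp unfolding is_MP_inverse_def by auto
  show "(a * b) * a = a" by (rule aba)
  show "is_projection star (a * b)"
    unfolding is_projection_def power2_eq_square
    using ab aba by (simp add: mult.assoc[symmetric])
  define s where "s = a * star a"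
  define t where "t = star b * b"
  \<comment> \<open>The adjoint of \<open>a (b a) = a\<close>, since \<open>b a\<close> is Hermite.\<close>
  have "b * a * star a = star a"
    using aba ba star(2)[of a "b * a"] by (simp add: mult.assoc)
  then have "t * s = star b * star a"
    unfolding t_def s_def by (simp add: mult.assoc)
  then have "t * s = a * b"
    using ab star(2)[of a b] by simp
  moreover have "(a * b) * s = s"
    unfolding s_def using aba by (simp add: mult.assoc[symmetric])
  ultimately have left: "t ^ n * s ^ n = a * b"
    using power_mult_power_collapse \<open>n > 0\<close> by blast
  have "star (t ^ n * s ^ n) = s ^ n * t ^ n"
    by (simp add: star star_power[OF inv] s_def t_def)
  then have right: "a * b = s ^ n * t ^ n"
    using left ab by simp
  show "two_sided_multiple (a * b) ((a * star a) ^ n)"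
    unfolding two_sided_multiple_def s_def[symmetric]
    using left[symmetric] right by blast
qed

text \<open>
  For an inner inverse \<open>c\<close> with both \<open>a c\<close> and \<open>c a\<close> Hermite, only \<open>c a c = c\<close>
  can fail; passing to \<open>c a c\<close> repairs this and keeps both products.
\<close>

lemma MP_inverse_from_inner_inverse:
  assumes "a * c * a = a" "is_Hermite star (a * c)" "is_Hermite star (c * a)"
  shows "is_MP_inverse star a (c * a * c)"
proof -
  have "a * (c * a * c) = a * c"
    using assms(1) by (simp add: mult.assoc[symmetric])
  moreover have ca: "(c * a * c) * a = c * a"
    using assms(1) by (simp add: mult.assoc)
  moreover have "(c * a * c) * a * (c * a * c) = c * a * c"
    using assms(1) by (simp add: ca) (simp add: mult.assoc[symmetric] ca)
  ultimately show ?thesis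
    using assms unfolding is_MP_inverse_def is_Hermite_def by simp
qed

text \<open>
  The equation \<open>a = y a a\<^sup>* a\<close> reads \<open>a = c\<^sup>* a\<^sup>* a\<close> with \<open>c = a\<^sup>* y\<^sup>*\<close>, so \<open>a c\<close> equals
  \<open>(a c)\<^sup>* (a c)\<close> and is Hermite, and \<open>a = (a c)\<^sup>* a = a c a\<close>.
  The last equation is \<open>a = a a\<^sup>* z\<close> with \<open>z = y\<^sup>* a\<close>, which is a condition of the
  mirrored kind; the mirrored argument shows that \<open>a\<^sup>* z = c a\<close> is Hermite.
\<close>

lemma MP_invertible_if_left_multiple_cube:
  assumes inv: "ring_involution star" and cube: "left_multiple a (a * star a * a)"
  shows "a \<in> MP_invertible star"
proof -
  note star = ring_involution_simps[OF inv]
  obtain y where y: "a = y * (a * star a * a)"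
    using cube unfolding left_multiple_def by auto
  define c where "c = star a * star y"
  define z where "z = star y * a"
  have star_c: "star c = y * a"
    unfolding c_def by (simp add: star)
  have a_c: "star c * star a * a = a"
    using y by (simp add: star_c mult.assoc)
  have "star (a * c) * (a * c) = a * c"
    using a_c by (simp add: star(2) mult.assoc[symmetric])
  then have ac: "star (a * c) = a * c"
    by (metis star)
  have aca: "a * c * a = a"
    using a_c ac by (simp add: star(2))
  have ca_z: "c * a = star a * z"
    unfolding c_def z_def by (simp add: mult.assoc)
  have "a * (c * a) = a"
    using aca by (simp add: mult.assoc)
  then have "star (c * a) * star a = star a"
    by (metis star(2))
  then have "star (c * a) * (c * a) = c * a"
    by (simp only: ca_z mult.assoc[symmetric])
  then have ca: "star (c * a) = c * a"
    by (metis star)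
  show ?thesis
    using MP_inverse_from_inner_inverse[of a c star] aca ac ca
    unfolding MP_invertible_def is_Hermite_def by blast
qed

lemma left_multiple_cube_if_left_multiple_power:
  assumes "b * a = a" "left_multiple b ((a * star a) ^ n)" "n > 0"
  shows "left_multiple a (a * star a * a)"
proof -
  obtain x where x: "b = x * (a * star a) ^ n"
    using assms(2) unfolding left_multiple_def by auto
  obtain m where "n = Suc m"
    using \<open>n > 0\<close> by (cases n) auto
  then have "b * a = (x * (a * star a) ^ m) * (a * star a * a)"
    unfolding x by (simp only: power_Suc2 mult.assoc)
  then show ?thesis
    unfolding left_multiple_def using assms(1) by auto
qed

theorem theorem3p4:
  fixes star :: "'a::{ring,monoid_mult} \<Rightarrow> 'a" and a :: 'a and n :: nat
  assumes "ring_involution star" and "n > 0"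
  shows "(a \<in> MP_invertible star \<longleftrightarrow>
            (\<exists>p. is_projection star p \<and> p * a = a \<and> two_sided_multiple p ((a * star a) ^ n)))
       \<and> (a \<in> MP_invertible star \<longleftrightarrow>
            (\<exists>q. is_Hermite star q \<and> q * a = a \<and> left_multiple q ((a * star a) ^ n)))
       \<and> (a \<in> MP_invertible star \<longleftrightarrow>
            (\<exists>r. is_Hermite star r \<and> r * a = a \<and> right_multiple r ((a * star a) ^ n)))
       \<and> (a \<in> MP_invertible star \<longleftrightarrow>
            (\<exists>b. b * a = a \<and> left_multiple b ((a * star a) ^ n)))"
proof -
  let ?s = "(a * star a) ^ n"
  let ?P1 = "a \<in> MP_invertible star"
  let ?P2 = "\<exists>p. is_projection star p \<and> p * a = a \<and> two_sided_multiple p ?s"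
  let ?P3 = "\<exists>q. is_Hermite star q \<and> q * a = a \<and> left_multiple q ?s"
  let ?P4 = "\<exists>r. is_Hermite star r \<and> r * a = a \<and> right_multiple r ?s"
  let ?P5 = "\<exists>b. b * a = a \<and> left_multiple b ?s"
  have "?P1 \<Longrightarrow> ?P2"
    using MP_inverse_range_projection[OF assms(1) _ assms(2)]
    unfolding MP_invertible_def by blast
  moreover have "?P2 \<Longrightarrow> ?P4"
    unfolding is_projection_def is_Hermite_def two_sided_multiple_def right_multiple_def
    by blast
  moreover have "?P4 \<Longrightarrow> ?P3"
    using Hermite_right_multiple_imp_left_multiple[OF assms(1)]
      Hermite_power_mult_star[OF assms(1)] by blast
  moreover have "?P3 \<Longrightarrow> ?P5"
    by blast
  moreover have "?P5 \<Longrightarrow> ?P1"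
    using left_multiple_cube_if_left_multiple_power[OF _ _ assms(2)]
      MP_invertible_if_left_multiple_cube[OF assms(1)] by blast
  ultimately show ?thesis by blast
qed

end
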